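(* Let $n$ be a positive integer. The size of every totally even subset of the edges of the $n \times n$ grid is of the form $4uv$ for some nonnegative integers $u$ and $v$ with $u + v = n$. Conversely, for all nonnegative integers $u$ and $v$ with $u + v = n$, there exists a totally even subset of the edges of the $n \times n$ grid of size $4uv$.
   Context: The $m \times n$ grid is the plane graph whose vertices are the integer points $(x, y)$ with $1 \le x \le m$ and $1 \le y \le n$ and whose edges are the unit segments between these points; its finite faces are the unit square cells. A subset $E$ of the edges of a planar graph $G$ is totally even when every vertex of $G$ is incident with an even number of edges of $E$ and every finite face of $G$ contains (on its boundary) an even number of edges of $E$. *)

theory Defs
  imports Main
begin

type_synonym point = "int \<times> int"

(* An edge is the set of its two endpoints. *)
type_synonym edge = "point set"

(* The plane graph enters through its vertex set V, its edge set G, and the set F of the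
   boundaries of its finite faces, each boundary given as the set of edges on it. *)
definition totally_even :: "'v set \<Rightarrow> 'v set set \<Rightarrow> 'v set set set \<Rightarrow> 'v set set \<Rightarrow> bool" where
  "totally_even V G F E \<longleftrightarrow>
     E \<subseteq> G \<and>
     (\<forall>v\<in>V. even (card {e \<in> E. v \<in> e})) \<and>
     (\<forall>f\<in>F. even (card (E \<inter> f)))"

definition horizontal_edge :: "int \<Rightarrow> int \<Rightarrow> edge" where
  "horizontal_edge x y = {(x, y), (x + 1, y)}"

definition vertical_edge :: "int \<Rightarrow> int \<Rightarrow> edge" where
  "vertical_edge x y = {(x, y), (x, y + 1)}"

definition grid_vertices :: "nat \<Rightarrow> nat \<Rightarrow> point set" where
  "grid_vertices m n = {1..int m} \<times> {1..int n}"

definition grid_edges :: "nat \<Rightarrow> nat \<Rightarrow> edge set" where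
  "grid_edges m n =
     {horizontal_edge x y | x y. 1 \<le> x \<and> x + 1 \<le> int m \<and> 1 \<le> y \<and> y \<le> int n} \<union>
     {vertical_edge x y | x y. 1 \<le> x \<and> x \<le> int m \<and> 1 \<le> y \<and> y + 1 \<le> int n}"

(* The four sides of the unit square with lower left corner (x, y). *)
definition cell_boundary :: "int \<Rightarrow> int \<Rightarrow> edge set" where
  "cell_boundary x y =
     {horizontal_edge x y, horizontal_edge x (y + 1), vertical_edge x y, vertical_edge (x + 1) y}"

definition grid_faces :: "nat \<Rightarrow> nat \<Rightarrow> edge set set" where
  "grid_faces m n =
     {cell_boundary x y | x y. 1 \<le> x \<and> x + 1 \<le> int m \<and> 1 \<le> y \<and> y + 1 \<le> int n}"

definition totally_even_in_grid :: "nat \<Rightarrow> nat \<Rightarrow> edge set \<Rightarrow> bool" where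
  "totally_even_in_grid m n E \<longleftrightarrow>
     totally_even (grid_vertices m n) (grid_edges m n) (grid_faces m n) E"

(* Hence card is the true size of every set of grid edges. *)
lemma finite_grid_edges: "finite (grid_edges m n)"
proof (rule finite_subset)
  show "grid_edges m n \<subseteq> Pow (grid_vertices m n)"
    by (auto simp: grid_edges_def grid_vertices_def horizontal_edge_def vertical_edge_def)
  show "finite (Pow (grid_vertices m n))"
    by (simp add: grid_vertices_def)
qed

(* The edges are exactly the pairs of vertices at distance 1. *)
lemma grid_edges_unit_distance:
  "grid_edges m n =
     {{(a, b), (c, d)} | a b c d. (a, b) \<in> grid_vertices m n \<and> (c, d) \<in> grid_vertices m n \<and>
        \<bar>a - c\<bar> + \<bar>b - d\<bar> = 1}" (is "_ = ?R")
proof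
  show "grid_edges m n \<subseteq> ?R"
    unfolding grid_edges_def grid_vertices_def horizontal_edge_def vertical_edge_def
    by fastforce
  show "?R \<subseteq> grid_edges m n"
  proof
    fix e assume "e \<in> ?R"
    then obtain a b c d where e: "e = {(a, b), (c, d)}"
      and v: "1 \<le> a" "a \<le> int m" "1 \<le> b" "b \<le> int n" "1 \<le> c" "c \<le> int m" "1 \<le> d" "d \<le> int n"
      and dist: "\<bar>a - c\<bar> + \<bar>b - d\<bar> = 1"
      by (auto simp: grid_vertices_def)
    from dist consider "c = a + 1" "d = b" | "a = c + 1" "d = b" | "c = a" "d = b + 1" | "c = a" "b = d + 1"
      by linarith
    then show "e \<in> grid_edges m n"
    proof cases
      case 1
      then have "e = horizontal_edge a b" by (simp add: e horizontal_edge_def)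
      with 1 v show ?thesis by (auto simp: grid_edges_def)
    next
      case 2
      then have "e = horizontal_edge c d" by (auto simp: e horizontal_edge_def)
      with 2 v show ?thesis by (auto simp: grid_edges_def)
    next
      case 3
      then have "e = vertical_edge a b" by (simp add: e vertical_edge_def)
      with 3 v show ?thesis by (auto simp: grid_edges_def)
    next
      case 4
      then have "e = vertical_edge c d" by (auto simp: e vertical_edge_def)
      with 4 v show ?thesis by (auto simp: grid_edges_def)
    qed
  qed
qed

end

theory Submission
  imports Defs
begin

text \<open>
  Double all coordinates and shift them, so that vertices become the points of the board
  \<open>{1..2m-1} \<times> {1..2n-1}\<close> with two odd coordinates, faces those with two even coordinates, and
  edges (through their midpoints) those with odd coordinate sum. A set of edges is totally even
  iff its indicator \<open>f\<close>, extended by zero, satisfies the discrete wave equation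
  \<open>f (x + 1) y + f (x - 1) y + f x (y + 1) + f x (y - 1) = 0\<close> modulo 2 at all other points of the
  board. As in d'Alembert's formula, the solutions for \<open>m = n\<close> are \<open>f x y = g (x + y) + g (x - y)\<close>
  where \<open>g\<close> is even and symmetric about \<open>2n\<close>, hence given by its values at the odd numbers below
  \<open>2n\<close>. Each unordered pair \<open>i \<noteq> j\<close> of such numbers is hit by exactly four edges, which the
  reflections in the two diagonals of the board permute. So if \<open>g\<close> takes one value \<open>u\<close> times and the
  other \<open>v\<close> times, the edge set has \<open>4uv\<close> elements.
\<close>

section \<open>Edge midpoints\<close>

text \<open>The argument is the doubled midpoint shifted by -1 in each coordinate, which puts the
  vertex \<open>(a, b)\<close> at \<open>(2 * a - 1, 2 * b - 1)\<close>. The two divisions agree on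
  an odd coordinate and differ by 1 on an even one.\<close>

definition midpoint_edge :: "int \<times> int \<Rightarrow> edge" where
  "midpoint_edge p =
     {((fst p + 1) div 2, (snd p + 1) div 2), ((fst p + 2) div 2, (snd p + 2) div 2)}"

definition midpoints :: "nat \<Rightarrow> nat \<Rightarrow> (int \<times> int) set" where
  "midpoints m n = {(x, y). 0 < x \<and> x < 2 * int m \<and> 0 < y \<and> y < 2 * int n \<and> odd (x + y)}"

definition neighbours :: "int \<Rightarrow> int \<Rightarrow> (int \<times> int) set" where
  "neighbours x y = {(x + 1, y), (x - 1, y), (x, y + 1), (x, y - 1)}"

lemma midpoint_edge_horizontal: "midpoint_edge (2 * x, 2 * y - 1) = horizontal_edge x y"
proof -
  have "(2 * x + 1) div 2 = x" "(2 * x + 2) div 2 = x + 1" "(2 * y - 1 + 2) div 2 = y"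
    by linarith+
  then show ?thesis by (simp add: midpoint_edge_def horizontal_edge_def)
qed

lemma midpoint_edge_vertical: "midpoint_edge (2 * x - 1, 2 * y) = vertical_edge x y"
proof -
  have "(2 * y + 1) div 2 = y" "(2 * y + 2) div 2 = y + 1" "(2 * x - 1 + 2) div 2 = x"
    by linarith+
  then show ?thesis by (simp add: midpoint_edge_def vertical_edge_def)
qed

text \<open>The two cases are the midpoints of horizontal and of vertical edges.\<close>

lemma odd_sum_cases:
  assumes "odd (x + y :: int)"
  obtains a b where "x = 2 * a" "y = 2 * b - 1" | a b where "x = 2 * a - 1" "y = 2 * b"
proof (cases "even x")
  case True
  then obtain a where "x = 2 * a" by (rule evenE)
  moreover from True assms have "even (y + 1)" by simp
  then obtain b where "y + 1 = 2 * b" by (rule evenE)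
  ultimately show ?thesis using that(1)[of a b] by simp
next
  case False
  then have "even (x + 1)" by simp
  then obtain a where "x + 1 = 2 * a" by (rule evenE)
  moreover from False assms have "even y" by simp
  then obtain b where "y = 2 * b" by (rule evenE)
  ultimately show ?thesis using that(2)[of a b] by simp
qed

lemma inj_on_midpoint_edge: "inj_on midpoint_edge {(x, y). odd (x + y)}"
proof (rule inj_on_inverseI, clarify)
  fix x y :: int
  assume "odd (x + y)"
  \<comment> \<open>The endpoints of an edge add up to twice its midpoint, so undoing the shift by 1
    gives a left inverse.\<close>
  then show "((\<Sum>v\<in>midpoint_edge (x, y). fst v) - 1, (\<Sum>v\<in>midpoint_edge (x, y). snd v) - 1) = (x, y)"
    by (cases rule: odd_sum_cases)
      (simp_all add: midpoint_edge_horizontal midpoint_edge_vertical horizontal_edge_def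
        vertical_edge_def)
qed

lemma midpoint_edge_image: "midpoint_edge ` midpoints m n = grid_edges m n"
proof
  show "midpoint_edge ` midpoints m n \<subseteq> grid_edges m n"
  proof clarify
    fix x y assume p: "(x, y) \<in> midpoints m n"
    then have "odd (x + y)" by (simp add: midpoints_def)
    then show "midpoint_edge (x, y) \<in> grid_edges m n"
      using p by (cases rule: odd_sum_cases)
        (fastforce simp: midpoint_edge_horizontal midpoint_edge_vertical midpoints_def
          grid_edges_def)+
  qed
  show "grid_edges m n \<subseteq> midpoint_edge ` midpoints m n"
  proof
    fix e assume "e \<in> grid_edges m n"
    then consider x y where "e = midpoint_edge (2 * x, 2 * y - 1)"
        "1 \<le> x" "x + 1 \<le> int m" "1 \<le> y" "y \<le> int n"
      | x y where "e = midpoint_edge (2 * x - 1, 2 * y)"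
        "1 \<le> x" "x \<le> int m" "1 \<le> y" "y + 1 \<le> int n"
      by (auto simp: grid_edges_def midpoint_edge_horizontal midpoint_edge_vertical)
    then show "e \<in> midpoint_edge ` midpoints m n"
      by cases (auto simp: midpoints_def)
  qed
qed

lemma inj_on_midpoints: "inj_on midpoint_edge (midpoints m n)"
  by (rule inj_on_subset[OF inj_on_midpoint_edge]) (auto simp: midpoints_def)

section \<open>Incidence with vertices and cells in board coordinates\<close>

lemma mem_midpoint_edge_iff:
  assumes "odd (p + q)"
  shows "(x, y) \<in> midpoint_edge (p, q) \<longleftrightarrow> (p, q) \<in> neighbours (2 * x - 1) (2 * y - 1)"
  using assms
  by (cases rule: odd_sum_cases)
    (simp add: midpoint_edge_horizontal midpoint_edge_vertical horizontal_edge_def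
      vertical_edge_def neighbours_def; presburger)+

text \<open>The cell with lower left corner \<open>(x, y)\<close> has its centre at the board point
  \<open>(2 * x, 2 * y)\<close>, and its sides are one step away.\<close>

lemma cell_boundary_eq: "cell_boundary x y = midpoint_edge ` neighbours (2 * x) (2 * y)"
  using midpoint_edge_horizontal[of x y] midpoint_edge_horizontal[of x "y + 1"]
    midpoint_edge_vertical[of x y] midpoint_edge_vertical[of "x + 1" y]
  by (simp add: cell_boundary_def neighbours_def insert_commute add.commute)

text \<open>The four neighbours are distinct, so the parity is the exclusive or of four memberships,
  written here as nested equivalences.\<close>

lemma even_card_Int_neighbours:
  "even (card (S \<inter> neighbours x y)) \<longleftrightarrow>
     (((x + 1, y) \<in> S \<longleftrightarrow> (x - 1, y) \<in> S) \<longleftrightarrow> ((x, y + 1) \<in> S \<longleftrightarrow> (x, y - 1) \<in> S))"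
  by (simp add: neighbours_def Int_insert_right)

lemma card_edges_at_vertex:
  assumes "S \<subseteq> midpoints m n"
  shows "card {e \<in> midpoint_edge ` S. (x, y) \<in> e} = card (S \<inter> neighbours (2 * x - 1) (2 * y - 1))"
proof -
  have "{e \<in> midpoint_edge ` S. (x, y) \<in> e} =
      midpoint_edge ` (S \<inter> neighbours (2 * x - 1) (2 * y - 1))"
    using assms by (fastforce simp: mem_midpoint_edge_iff midpoints_def)
  moreover have "inj_on midpoint_edge (S \<inter> neighbours (2 * x - 1) (2 * y - 1))"
    using inj_on_subset[OF inj_on_midpoints] assms by blast
  ultimately show ?thesis by (simp add: card_image)
qed

lemma card_edges_of_face:
  assumes "S \<subseteq> midpoints m n"
  shows "card (midpoint_edge ` S \<inter> cell_boundary x y) = card (S \<inter> neighbours (2 * x) (2 * y))"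
proof -
  have sub: "S \<subseteq> {(x, y). odd (x + y)}" "neighbours (2 * x) (2 * y) \<subseteq> {(x, y). odd (x + y)}"
    using assms by (auto simp: midpoints_def neighbours_def)
  have "midpoint_edge ` S \<inter> cell_boundary x y = midpoint_edge ` (S \<inter> neighbours (2 * x) (2 * y))"
    using inj_on_image_Int[OF inj_on_midpoint_edge sub] by (simp add: cell_boundary_eq)
  moreover have "inj_on midpoint_edge (S \<inter> neighbours (2 * x) (2 * y))"
    by (rule inj_on_subset[OF inj_on_midpoint_edge]) (use sub in blast)
  ultimately show ?thesis by (simp add: card_image)
qed

definition wave :: "nat \<Rightarrow> nat \<Rightarrow> (int \<times> int) set \<Rightarrow> bool" where
  "wave m n S \<longleftrightarrow> (\<forall>x y. 0 < x \<and> x < 2 * int m \<and> 0 < y \<and> y < 2 * int n \<and> even (x + y) \<longrightarrow>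
     even (card (S \<inter> neighbours x y)))"

lemma totally_even_iff_wave:
  assumes "S \<subseteq> midpoints m n"
  shows "totally_even_in_grid m n (midpoint_edge ` S) \<longleftrightarrow> wave m n S"
proof -
  have "midpoint_edge ` S \<subseteq> grid_edges m n"
    using assms midpoint_edge_image by blast
  moreover have "(\<forall>f\<in>grid_faces m n. Q f) \<longleftrightarrow>
      (\<forall>x y. 1 \<le> x \<and> x + 1 \<le> int m \<and> 1 \<le> y \<and> y + 1 \<le> int n \<longrightarrow> Q (cell_boundary x y))" for Q
    unfolding grid_faces_def by blast
  ultimately have "totally_even_in_grid m n (midpoint_edge ` S) \<longleftrightarrow>
      (\<forall>x y. 1 \<le> x \<and> x \<le> int m \<and> 1 \<le> y \<and> y \<le> int n \<longrightarrow>
         even (card (S \<inter> neighbours (2 * x - 1) (2 * y - 1)))) \<and>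
      (\<forall>x y. 1 \<le> x \<and> x + 1 \<le> int m \<and> 1 \<le> y \<and> y + 1 \<le> int n \<longrightarrow>
         even (card (S \<inter> neighbours (2 * x) (2 * y))))"
    by (auto simp: totally_even_in_grid_def totally_even_def grid_vertices_def
        card_edges_at_vertex[OF assms] card_edges_of_face[OF assms])
  \<comment> \<open>An even coordinate sum means that both coordinates are odd, the vertex
    condition, or both even, the face condition.\<close>
  also have "\<dots> \<longleftrightarrow> wave m n S" (is "?V \<and> ?F \<longleftrightarrow> _")
  proof
    assume VF: "?V \<and> ?F"
    show "wave m n S"
      unfolding wave_def
    proof (intro allI impI)
      fix x y :: int
      assume xy: "0 < x \<and> x < 2 * int m \<and> 0 < y \<and> y < 2 * int n \<and> even (x + y)"
      show "even (card (S \<inter> neighbours x y))"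
      proof (cases "even x")
        case True
        with xy have "even y" by simp
        with True obtain a b where "x = 2 * a" "y = 2 * b" by (auto elim!: evenE)
        with xy VF show ?thesis by simp
      next
        case False
        with xy have "even (x + 1)" "even (y + 1)" by simp_all
        then obtain a b where "x + 1 = 2 * a" "y + 1 = 2 * b" by (meson evenE)
        then have "x = 2 * a - 1" "y = 2 * b - 1" by simp_all
        with xy VF show ?thesis by simp
      qed
    qed
  next
    assume "wave m n S"
    then show "?V \<and> ?F" by (simp add: wave_def)
  qed
  finally show ?thesis .
qed

section \<open>Solutions of the wave equation\<close>

text \<open>Folds the sums and differences that occur on the board into \<open>{0..2n}\<close>, so
  that \<open>g\<close> composed with it is even and symmetric about \<open>2n\<close>
  there.\<close>

definition reflect :: "nat \<Rightarrow> int \<Rightarrow> int" where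
  "reflect n s = (if s < 2 * int n then \<bar>s\<bar> else 4 * int n - s)"

definition wave_set :: "nat \<Rightarrow> (int \<Rightarrow> bool) \<Rightarrow> (int \<times> int) set" where
  "wave_set n g = {(x, y). g (reflect n (x + y)) \<noteq> g (reflect n (x - y))}"

text \<open>The two arguments of \<open>g\<close> coincide for \<open>y = 0\<close>, are exchanged
  by the sign change for \<open>x = 0\<close> and by the symmetry about \<open>2n\<close> for
  \<open>x = 2n\<close>; the side \<open>y = 2n\<close> combines both reflections.\<close>

lemma wave_set_boundary:
  assumes "0 \<le> x" "x \<le> 2 * int n" "0 \<le> y" "y \<le> 2 * int n"
    and "x = 0 \<or> y = 0 \<or> x = 2 * int n \<or> y = 2 * int n"
  shows "(x, y) \<notin> wave_set n g"
proof -
  have "reflect n (x + y) = reflect n (x - y)"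
    using assms by (auto simp: reflect_def)
  then show ?thesis by (simp add: wave_set_def)
qed

text \<open>Each of the values at \<open>x + y + 1\<close>, \<open>x + y - 1\<close>,
  \<open>x - y + 1\<close> and \<open>x - y - 1\<close> occurs at exactly two neighbours and cancels
  modulo 2.\<close>

lemma wave_set_neighbours: "even (card (wave_set n g \<inter> neighbours x y))"
  unfolding even_card_Int_neighbours wave_set_def by (auto simp: algebra_simps)

lemma wave_wave_set: "wave n n (wave_set n g \<inter> midpoints n n)"
  unfolding wave_def
proof (intro allI impI)
  fix x y :: int
  assume xy: "0 < x \<and> x < 2 * int n \<and> 0 < y \<and> y < 2 * int n \<and> even (x + y)"
  \<comment> \<open>Neighbours outside the board lie on its border, where \<open>wave_set\<close>
    vanishes, so restricting to \<open>midpoints\<close> changes no count.\<close>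
  have "q \<in> midpoints n n" if "q \<in> wave_set n g" "q \<in> neighbours x y" for q
  proof (rule ccontr)
    assume *: "q \<notin> midpoints n n"
    obtain a b where q: "q = (a, b)" by (cases q)
    have "0 \<le> a" "a \<le> 2 * int n" "0 \<le> b" "b \<le> 2 * int n"
      "a = 0 \<or> b = 0 \<or> a = 2 * int n \<or> b = 2 * int n"
      using xy that(2) * by (auto simp: neighbours_def midpoints_def q)
    from wave_set_boundary[OF this] that(1) q show False by simp
  qed
  then have "wave_set n g \<inter> midpoints n n \<inter> neighbours x y = wave_set n g \<inter> neighbours x y"
    by blast
  then show "even (card (wave_set n g \<inter> midpoints n n \<inter> neighbours x y))"
    by (simp add: wave_set_neighbours)
qed

lemma wave_step:
  assumes "wave n n S" "wave n n T"
    and "0 < x" "x < 2 * int n" "0 < y" "y < 2 * int n" "even (x + y)"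
    and "\<And>q. q \<in> {(x - 1, y), (x, y + 1), (x, y - 1)} \<Longrightarrow> q \<in> S \<longleftrightarrow> q \<in> T"
  shows "(x + 1, y) \<in> S \<longleftrightarrow> (x + 1, y) \<in> T"
proof -
  have "even (card (S \<inter> neighbours x y))" "even (card (T \<inter> neighbours x y))"
    using assms by (auto simp: wave_def)
  then show ?thesis
    using assms(8) unfolding even_card_Int_neighbours by auto
qed

text \<open>The first column determines a solution, as the zeroth column vanishes.\<close>

lemma wave_unique:
  assumes "wave n n S" "wave n n T" "S \<subseteq> midpoints n n" "T \<subseteq> midpoints n n"
    and first: "\<And>y. (1, y) \<in> S \<longleftrightarrow> (1, y) \<in> T"
  shows "S = T"
proof -
  have column: "(\<forall>y. (int k, y) \<in> S \<longleftrightarrow> (int k, y) \<in> T)" for k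
  proof (induction k rule: less_induct)
    case (less k)
    consider "k = 0" | "k = 1" | j where "k = Suc (Suc j)"
      by (metis One_nat_def not0_implies_Suc)
    then show ?case
    proof cases
      case 1
      then show ?thesis using assms(3,4) by (auto simp: midpoints_def)
    next
      case 2
      then show ?thesis using first by simp
    next
      case 3
      show ?thesis
      proof
        fix y
        show "(int k, y) \<in> S \<longleftrightarrow> (int k, y) \<in> T"
        proof (cases "(int k, y) \<in> midpoints n n")
          case True
          have IH: "(int j, b) \<in> S \<longleftrightarrow> (int j, b) \<in> T"
            "(int j + 1, b) \<in> S \<longleftrightarrow> (int j + 1, b) \<in> T" for b
            using less[of j] less[of "Suc j"] 3 by (auto simp: add.commute)
          \<comment> \<open>The equation centred in column \<open>j + 1\<close> determines column
            \<open>j + 2\<close> from the two columns before it.\<close>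
          have "(int j + 1 + 1, y) \<in> S \<longleftrightarrow> (int j + 1 + 1, y) \<in> T"
            by (rule wave_step[OF assms(1,2)]) (use True 3 IH in \<open>auto simp: midpoints_def\<close>)
          then show ?thesis using 3 by (simp add: add.commute)
        next
          case False
          then show ?thesis using assms(3,4) by blast
        qed
      qed
    qed
  qed
  have "(x, y) \<in> S \<longleftrightarrow> (x, y) \<in> T" for x y
  proof (cases "0 < x")
    case True
    then show ?thesis using column[of "nat x"] by simp
  next
    case False
    then show ?thesis using assms(3,4) by (auto simp: midpoints_def)
  qed
  then show ?thesis by auto
qed

text \<open>Summing the first column modulo 2 yields a \<open>g\<close> whose
  \<open>wave_set\<close> has the same first column, and uniqueness does the rest.\<close>

lemma wave_eq_wave_set:
  assumes "wave n n S" and S: "S \<subseteq> midpoints n n"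
  obtains g where "S = wave_set n g \<inter> midpoints n n"
proof -
  define C where "C i = {j. (1, j) \<in> S \<and> 0 < j \<and> j < i}" for i :: int
  define g where "g i \<longleftrightarrow> odd (card (C i))" for i
  have jump: "g (y + 1) \<noteq> g (y - 1) \<longleftrightarrow> (1, y) \<in> S" if "0 < y" "even y" for y
  proof -
    \<comment> \<open>Members of the first column have even height, so raising the bound from
      \<open>y - 1\<close> to \<open>y + 1\<close> can add only \<open>y\<close>.\<close>
    have *: "j < y + 1 \<longleftrightarrow> j = y \<or> j < y - 1" if "(1, j) \<in> S" for j
    proof -
      have "even j" using that S by (auto simp: midpoints_def)
      with \<open>even y\<close> have "j \<noteq> y - 1" by auto
      then show ?thesis by linarith
    qed
    have fin: "finite (C (y - 1))"
      by (rule finite_subset[of _ "{0..y}"]) (auto simp: C_def)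
    show ?thesis
    proof (cases "(1, y) \<in> S")
      case True
      then have "C (y + 1) = insert y (C (y - 1))"
        using * that by (auto simp: C_def)
      moreover have "y \<notin> C (y - 1)" by (simp add: C_def)
      ultimately show ?thesis using fin True by (simp add: g_def)
    next
      case False
      then have "C (y + 1) = C (y - 1)"
        using * by (auto simp: C_def)
      then show ?thesis using False by (simp add: g_def)
    qed
  qed
  have "S = wave_set n g \<inter> midpoints n n"
  proof (rule wave_unique[OF assms(1) wave_wave_set S])
    fix y
    show "(1, y) \<in> S \<longleftrightarrow> (1, y) \<in> wave_set n g \<inter> midpoints n n"
    proof (cases "(1, y) \<in> midpoints n n")
      case True
      then have y: "0 < y" "even y" "y + 1 < 2 * int n"
        by (auto simp: midpoints_def)
      then have "reflect n (1 + y) = y + 1" "reflect n (1 - y) = y - 1"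
        by (auto simp: reflect_def)
      with True jump[OF y(1,2)] show ?thesis by (auto simp: wave_set_def)
    next
      case False
      then show ?thesis using S by blast
    qed
  qed auto
  then show ?thesis by (rule that)
qed

section \<open>Counting\<close>

definition odds_below :: "nat \<Rightarrow> int set" where
  "odds_below n = {i. odd i \<and> 0 < i \<and> i < 2 * int n}"

lemma odds_below_eq: "odds_below n = (\<lambda>k. 2 * int k + 1) ` {..<n}"
proof
  show "odds_below n \<subseteq> (\<lambda>k. 2 * int k + 1) ` {..<n}"
  proof
    fix i assume i: "i \<in> odds_below n"
    then obtain k where "i = 2 * k + 1" by (auto simp: odds_below_def elim: oddE)
    with i have "i = 2 * int (nat k) + 1" "nat k < n" by (auto simp: odds_below_def)
    then show "i \<in> (\<lambda>k. 2 * int k + 1) ` {..<n}" by blast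
  qed
qed (auto simp: odds_below_def)

lemma finite_odds_below: "finite (odds_below n)"
  by (simp add: odds_below_eq)

lemma card_odds_below: "card (odds_below n) = n"
  by (simp add: odds_below_eq card_image inj_on_def)

text \<open>A point of the set corresponds to a pair with \<open>g\<close> true at the first entry
  and false at the second, together with one bit for each diagonal telling on which side the point
  lies.\<close>

lemma card_wave_set:
  "card (wave_set n g \<inter> midpoints n n) =
     4 * card {i \<in> odds_below n. g i} * card {i \<in> odds_below n. \<not> g i}"
proof -
  define U where "U = {i \<in> odds_below n. g i}"
  define V where "V = {i \<in> odds_below n. \<not> g i}"
  define encode :: "int \<times> int \<Rightarrow> (int \<times> int) \<times> bool \<times> bool" where
    "encode = (\<lambda>(x, y). let s = reflect n (x + y); d = \<bar>x - y\<bar> in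
       (if g s then (s, d) else (d, s), y < x, x + y < 2 * int n))"
  \<comment> \<open>The folded sum always exceeds the absolute difference, so \<open>max\<close> and
    \<open>min\<close> tell them apart after \<open>encode\<close> has ordered them by their value
    under \<open>g\<close>. The bits undo the folding and the absolute value.\<close>
  define decode :: "(int \<times> int) \<times> bool \<times> bool \<Rightarrow> int \<times> int" where
    "decode = (\<lambda>((i, j), b, c).
       let s = (if c then max i j else 4 * int n - max i j); d = (if b then min i j else - min i j)
       in ((s + d) div 2, (s - d) div 2))"
  have "bij_betw encode (wave_set n g \<inter> midpoints n n) ((U \<times> V) \<times> UNIV \<times> UNIV)"
  proof (rule bij_betw_byWitness[where f' = decode])
    have decode_encode: "decode (encode p) = p \<and> encode p \<in> (U \<times> V) \<times> UNIV \<times> UNIV"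
      if "p \<in> wave_set n g" "p \<in> midpoints n n" for p
    proof -
      obtain x y where p: "p = (x, y)" by (cases p)
      define s where "s = reflect n (x + y)"
      define d where "d = \<bar>x - y\<bar>"
      have xy: "0 < x" "x < 2 * int n" "0 < y" "y < 2 * int n" "odd (x + y)"
        using that(2) by (auto simp: p midpoints_def)
      \<comment> \<open>By parity no edge midpoint lies on a diagonal; hence the strict inequalities
        that follow.\<close>
      then have "x + y \<noteq> 2 * int n" "x \<noteq> y" by (metis even_add dvd_triv_left)+
      with xy have "d < s" "0 < d" "s < 2 * int n"
        by (auto simp: s_def d_def reflect_def)
      moreover have "odd s" "odd d"
        using xy by (auto simp: s_def d_def reflect_def)
      moreover have "g s \<noteq> g d"
        using that(1) xy by (simp add: p wave_set_def s_def d_def reflect_def)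
      moreover have "encode (x, y) = (if g s then (s, d) else (d, s), y < x, x + y < 2 * int n)"
        by (simp add: encode_def s_def d_def Let_def)
      moreover have "(if x + y < 2 * int n then s else 4 * int n - s) = x + y"
        "(if y < x then d else - d) = x - y"
        using xy by (auto simp: s_def d_def reflect_def)
      ultimately show ?thesis
        by (auto simp: p decode_def Let_def max_def min_def U_def V_def odds_below_def)
    qed
    then show "\<forall>p\<in>wave_set n g \<inter> midpoints n n. decode (encode p) = p"
      "encode ` (wave_set n g \<inter> midpoints n n) \<subseteq> (U \<times> V) \<times> UNIV \<times> UNIV"
      using decode_encode by blast+
    have encode_decode: "encode (decode ((i, j), b, c)) = ((i, j), b, c) \<and>
        decode ((i, j), b, c) \<in> wave_set n g \<inter> midpoints n n"
      if "i \<in> U" "j \<in> V" for i j b c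
    proof -
      define M where "M = max i j"
      define m where "m = min i j"
      define s where "s = (if c then M else 4 * int n - M)"
      define d where "d = (if b then m else - m)"
      define x where "x = (s + d) div 2"
      define y where "y = (s - d) div 2"
      have ij: "odd i" "odd j" "0 < i" "0 < j" "i < 2 * int n" "j < 2 * int n" "g i" "\<not> g j"
        using that by (auto simp: U_def V_def odds_below_def)
      then have "i \<noteq> j" by auto
      with ij have Mm: "odd M" "odd m" "0 < m" "m < M" "M < 2 * int n"
        by (auto simp: M_def m_def max_def min_def)
      then have "odd s" "odd d" by (auto simp: s_def d_def)
      \<comment> \<open>Both \<open>s\<close> and \<open>d\<close> are odd, so the halving is
        exact.\<close>
      then have "2 * x = s + d" "2 * y = s - d" by (simp_all add: x_def y_def)
      then have sd: "x + y = s" "x - y = d" by auto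
      have "decode ((i, j), b, c) = (x, y)"
        by (simp add: decode_def Let_def x_def y_def s_def d_def M_def m_def)
      moreover have s: "reflect n s = M" "s < 2 * int n \<longleftrightarrow> c"
        and d: "\<bar>d\<bar> = m" "reflect n d = m" "0 < d \<longleftrightarrow> b"
        using Mm by (auto simp: s_def d_def reflect_def)
      moreover have "(x, y) \<in> midpoints n n"
      proof -
        have "0 < x" "x < 2 * int n" "0 < y" "y < 2 * int n"
          using \<open>2 * x = s + d\<close> \<open>2 * y = s - d\<close> Mm
          by (auto simp: s_def d_def split: if_splits)
        moreover have "odd (x + y)" using sd \<open>odd s\<close> by simp
        ultimately show ?thesis by (simp add: midpoints_def)
      qed
      moreover have "g M \<noteq> g m" "(if g M then (M, m) else (m, M)) = (i, j)"
        using ij by (auto simp: M_def m_def max_def min_def)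
      moreover have "y < x \<longleftrightarrow> 0 < d" using sd by auto
      ultimately show ?thesis
        by (auto simp: encode_def Let_def wave_set_def sd split: if_splits)
    qed
    then show "\<forall>p\<in>(U \<times> V) \<times> UNIV \<times> UNIV. encode (decode p) = p"
      "decode ` ((U \<times> V) \<times> UNIV \<times> UNIV) \<subseteq> wave_set n g \<inter> midpoints n n"
      by auto
  qed
  then have "card (wave_set n g \<inter> midpoints n n) =
      card ((U \<times> V) \<times> (UNIV :: bool set) \<times> (UNIV :: bool set))"
    by (rule bij_betw_same_card)
  then show ?thesis
    by (simp add: card_cartesian_product U_def V_def del: UNIV_Times_UNIV)
qed

theorem lemma6:
  fixes n :: nat
  assumes "n \<ge> 1"
  shows "(\<forall>E. totally_even_in_grid n n E \<longrightarrow>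
            (\<exists>u v :: nat. u + v = n \<and> card E = 4 * u * v)) \<and>
         (\<forall>u v :: nat. u + v = n \<longrightarrow>
            (\<exists>E. totally_even_in_grid n n E \<and> card E = 4 * u * v))"
proof (intro conjI allI impI)
  fix E assume E: "totally_even_in_grid n n E"
  then have "E \<subseteq> midpoint_edge ` midpoints n n"
    by (simp add: midpoint_edge_image totally_even_in_grid_def totally_even_def)
  then obtain S where S: "S \<subseteq> midpoints n n" "E = midpoint_edge ` S"
    by (auto simp: subset_image_iff)
  with E have "wave n n S" by (simp add: totally_even_iff_wave)
  then obtain g where g: "S = wave_set n g \<inter> midpoints n n"
    using S(1) by (rule wave_eq_wave_set)
  have "card E = card S"
    using S inj_on_subset[OF inj_on_midpoints] by (simp add: card_image)
  then have "card E = 4 * card {i \<in> odds_below n. g i} * card {i \<in> odds_below n. \<not> g i}"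
    by (simp add: g card_wave_set)
  moreover have "card {i \<in> odds_below n. g i} + card {i \<in> odds_below n. \<not> g i} = n"
  proof -
    have "card ({i \<in> odds_below n. g i} \<union> {i \<in> odds_below n. \<not> g i}) =
        card {i \<in> odds_below n. g i} + card {i \<in> odds_below n. \<not> g i}"
      by (rule card_Un_disjoint) (auto simp: finite_odds_below)
    moreover have "{i \<in> odds_below n. g i} \<union> {i \<in> odds_below n. \<not> g i} = odds_below n"
      by blast
    ultimately show ?thesis by (simp add: card_odds_below)
  qed
  ultimately show "\<exists>u v. u + v = n \<and> card E = 4 * u * v" by blast
next
  fix u v :: nat
  assume uv: "u + v = n"
  \<comment> \<open>Exactly \<open>u\<close> of the \<open>n\<close> odd numbers lie below this
    threshold, which leaves \<open>v\<close> above it.\<close>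
  define g where "g i \<longleftrightarrow> i < 2 * int u" for i
  define S where "S = wave_set n g \<inter> midpoints n n"
  have S: "S \<subseteq> midpoints n n" by (simp add: S_def)
  have "{i \<in> odds_below n. g i} = odds_below u"
    using uv by (auto simp: odds_below_def g_def)
  then have U: "card {i \<in> odds_below n. g i} = u"
    by (simp add: card_odds_below)
  have "{i \<in> odds_below n. \<not> g i} = odds_below n - odds_below u"
    by (auto simp: odds_below_def g_def)
  moreover have "odds_below u \<subseteq> odds_below n"
    using uv by (auto simp: odds_below_def)
  ultimately have "card {i \<in> odds_below n. \<not> g i} = v"
    using uv by (simp add: card_Diff_subset finite_odds_below card_odds_below)
  with U have "card S = 4 * u * v" by (simp add: S_def card_wave_set)
  moreover have "card (midpoint_edge ` S) = card S"
    using S inj_on_subset[OF inj_on_midpoints] by (simp add: card_image)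
  moreover have "totally_even_in_grid n n (midpoint_edge ` S)"
    using totally_even_iff_wave[OF S] wave_wave_set by (simp add: S_def)
  ultimately show "\<exists>E. totally_even_in_grid n n E \<and> card E = 4 * u * v" by auto
qed

end
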